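(* Let $X$ be a finite cycle set and assume that $X$ admits a covering map $p\colon X\to Y$ onto a finite cycle set $Y$. Then there exist a finite nonempty set $S$ and a dynamical cocycle $\alpha$ of $Y$ with values on $S$ (that is, $\alpha\in Z^2(Y,S)$) such that $X$ is isomorphic, as a cycle set, to the dynamical extension $S\times_\alpha Y$.
   Context: A cycle set is a set $X$ with a binary operation $X\times X\to X$, $(x,y)\mapsto x\cdot y$, such that for each $x\in X$ the map $\varphi_x\colon X\to X$, $y\mapsto x\cdot y$, is bijective and $(x\cdot y)\cdot(x\cdot z)=(y\cdot x)\cdot(y\cdot z)$ for all $x,y,z\in X$. A homomorphism of cycle sets is a map $f$ with $f(x\cdot y)=f(x)\cdot f(y)$ for all $x,y$; an isomorphism is a bijective homomorphism. A homomorphism $p\colon X\to Y$ between finite cycle sets is a covering map if it is surjective and all the fibers $p^{-1}(y)$, $y\in Y$, have the same cardinality. Let $Y$ be a finite cycle set, $S$ a finite nonempty set, and $\operatorname{Sym}(S)$ the set of permutations of $S$. A dynamical cocycle of $Y$ with values on $S$ is a map $\alpha\colon Y\times Y\times S\to \operatorname{Sym}(S)$, $(x,y,s)\mapsto\alpha_{x,y}(s,-)$ (where $\alpha_{x,y}(s,-)$ denotes the map $t\mapsto\alpha_{x,y}(s,t)$), such that $$\alpha_{x\cdot y,x\cdot z}(\alpha_{x,y}(r,s),\alpha_{x,z}(r,t))=\alpha_{y\cdot x,y\cdot z}(\alpha_{y,x}(s,r),\alpha_{y,z}(s,t))$$ for all $x,y,z\in Y$ and $r,s,t\in S$. The set of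 these is denoted $Z^2(Y,S)$. For $\alpha\in Z^2(Y,S)$, the dynamical extension $S\times_\alpha Y$ is the set $S\times Y$ with the operation $(s,x)\cdot(t,y)=(\alpha_{x,y}(s,t),x\cdot y)$; it is a cycle set. *)

theory Defs
  imports "HOL-Library.FuncSet" "HOL-Combinatorics.Permutations"
begin

text \<open>Cycle sets are sets \<open>X\<close> with an operation on the ambient type, of which only the values
  on \<open>X\<close> matter. Closure of \<open>X\<close> under the operation is part of the bijectivity axiom.\<close>

locale cycle_set =
  fixes X :: "'a set" and opX :: "'a \<Rightarrow> 'a \<Rightarrow> 'a" (infixl "\<cdot>" 70)
  assumes bij_left: "x \<in> X \<Longrightarrow> bij_betw (\<lambda>y. x \<cdot> y) X X"
    and cycle_eq: "\<lbrakk>x \<in> X; y \<in> X; z \<in> X\<rbrakk> \<Longrightarrow>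
      (x \<cdot> y) \<cdot> (x \<cdot> z) = (y \<cdot> x) \<cdot> (y \<cdot> z)"

locale cycle_set_hom =
  source: cycle_set X opX + target: cycle_set Y opY
  for X :: "'a set" and opX (infixl "\<cdot>\<^sub>X" 70)
    and Y :: "'b set" and opY (infixl "\<cdot>\<^sub>Y" 70) +
  fixes f :: "'a \<Rightarrow> 'b"
  assumes maps_to: "f \<in> X \<rightarrow> Y"
    and hom_op: "\<lbrakk>x \<in> X; y \<in> X\<rbrakk> \<Longrightarrow> f (x \<cdot>\<^sub>X y) = f x \<cdot>\<^sub>Y f y"

locale cycle_set_iso = cycle_set_hom +
  assumes bijective: "bij_betw f X Y"

definition cycle_set_isomorphic ::
  "'a set \<Rightarrow> ('a \<Rightarrow> 'a \<Rightarrow> 'a) \<Rightarrow> 'b set \<Rightarrow> ('b \<Rightarrow> 'b \<Rightarrow> 'b) \<Rightarrow> bool" where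
  "cycle_set_isomorphic X opX Y opY \<longleftrightarrow> (\<exists>f. cycle_set_iso X opX Y opY f)"

locale covering_map = cycle_set_hom X opX Y opY p
  for X :: "'a set" and opX (infixl "\<cdot>\<^sub>X" 70)
    and Y :: "'b set" and opY (infixl "\<cdot>\<^sub>Y" 70)
    and p :: "'a \<Rightarrow> 'b" +
  assumes finite_source: "finite X"
    and finite_target: "finite Y"
    and surjective: "p ` X = Y"
    and fibers_same_card: "\<lbrakk>y \<in> Y; y' \<in> Y\<rbrakk> \<Longrightarrow>
      card {x \<in> X. p x = y} = card {x \<in> X. p x = y'}"

text \<open>The set \<open>Z\<^sup>2(Y,S)\<close>: mathematically, \<open>\<alpha>\<^bsub>x,y\<^esub>(s,t)\<close> is \<open>\<alpha> x y s t\<close>. An element of \<open>Sym(S)\<close> is a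
  function that \<open>permutes\<close> \<open>S\<close>, hence is the identity off \<open>S\<close>. The values of \<open>\<alpha> x y s\<close> for
  arguments outside \<open>Y \<times> Y \<times> S\<close> are unconstrained.\<close>

definition dynamical_cocycles ::
  "'b set \<Rightarrow> ('b \<Rightarrow> 'b \<Rightarrow> 'b) \<Rightarrow> 's set \<Rightarrow> ('b \<Rightarrow> 'b \<Rightarrow> 's \<Rightarrow> 's \<Rightarrow> 's) set" where
  "dynamical_cocycles Y opY S = {\<alpha>.
     (\<forall>x\<in>Y. \<forall>y\<in>Y. \<forall>s\<in>S. \<alpha> x y s permutes S) \<and>
     (\<forall>x\<in>Y. \<forall>y\<in>Y. \<forall>z\<in>Y. \<forall>r\<in>S. \<forall>s\<in>S. \<forall>t\<in>S.
        \<alpha> (opY x y) (opY x z) (\<alpha> x y r s) (\<alpha> x z r t) =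
        \<alpha> (opY y x) (opY y z) (\<alpha> y x s r) (\<alpha> y z s t))}"

definition dynamical_extension_op ::
  "('b \<Rightarrow> 'b \<Rightarrow> 's \<Rightarrow> 's \<Rightarrow> 's) \<Rightarrow> ('b \<Rightarrow> 'b \<Rightarrow> 'b) \<Rightarrow> 's \<times> 'b \<Rightarrow> 's \<times> 'b \<Rightarrow> 's \<times> 'b" where
  "dynamical_extension_op \<alpha> opY = (\<lambda>(s, x) (t, y). (\<alpha> x y s t, opY x y))"

end

theory Submission
  imports Defs
begin

text \<open>
  A covering map is a dynamical extension because equality of the fiber sizes allows all fibers to
  be labelled by one set. Choose a set \<open>S\<close> of the common size and bijections \<open>h y\<close> from the fibers
  \<open>p\<^sup>-\<^sup>1(y)\<close> onto \<open>S\<close>. Then \<open>a \<mapsto> (h (p a) a, p a)\<close> is a bijection from \<open>X\<close> onto \<open>S \<times> Y\<close>. The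
  operation that it carries over from \<open>X\<close> is given in the second coordinate by the operation of
  \<open>Y\<close>, since \<open>p\<close> is a homomorphism. Its first coordinate defines \<open>\<alpha>\<close>.

  Two things make \<open>\<alpha>\<close> a cocycle. Left multiplication by an element \<open>a\<close> restricts to a bijection
  between the fibers over \<open>y\<close> and \<open>p a \<cdot> y\<close> (lemma \<open>bij_betw_left_mult_fiber\<close>). Hence the values of \<open>\<alpha>\<close> are permutations. The cocycle
  identity need not be computed: it is the first coordinate of the cycle set equation on \<open>S \<times> Y\<close>,
  which holds because the operation there is transported from a cycle set
  (lemmas \<open>cycle_set_iso_transport\<close> and \<open>cocycle_identity_of_extension\<close>).
\<close>

text \<open>Every element of \<open>Z\<close> is a value of \<open>f\<close>, so both axioms for \<open>opZ\<close> are images of those in \<open>X\<close>.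
  Thus the dynamical extension is recognised as a cycle set before \<open>\<alpha>\<close> is known to be a cocycle.\<close>

lemma (in cycle_set) cycle_set_iso_transport:
  assumes bij: "bij_betw f X Z"
    and op: "\<And>a b. \<lbrakk>a \<in> X; b \<in> X\<rbrakk> \<Longrightarrow> f (a \<cdot> b) = opZ (f a) (f b)"
  shows "cycle_set_iso X opX Z opZ f"
proof -
  have closed: "a \<cdot> b \<in> X" if "a \<in> X" "b \<in> X" for a b
    using bij_left[OF that(1)] that(2) by (rule bij_betwE[rule_format])
  have Z: "Z = f ` X"
    using bij by (simp add: bij_betw_def)
  have left: "bij_betw (opZ (f a)) Z Z" if a: "a \<in> X" for a
  proof -
    have "bij_betw (f \<circ> (\<cdot>) a) X Z"
      using bij_betw_trans[OF bij_left[OF a] bij] .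
    then have "bij_betw (opZ (f a) \<circ> f) X Z"
      by (rule bij_betw_cong[THEN iffD1, rotated]) (simp add: a op)
    then show ?thesis
      using bij_betw_comp_iff[OF bij] by blast
  qed
  have "cycle_set Z opZ"
  proof
    show "bij_betw (opZ u) Z Z" if "u \<in> Z" for u
      using that left by (auto simp: Z)
    show "opZ (opZ u v) (opZ u w) = opZ (opZ v u) (opZ v w)"
      if uvw: "u \<in> Z" "v \<in> Z" "w \<in> Z" for u v w
    proof -
      obtain a b c where abc: "a \<in> X" "b \<in> X" "c \<in> X" and u: "u = f a" and v: "v = f b" and w: "w = f c"
        using uvw unfolding Z by blast
      show ?thesis
        using arg_cong[OF cycle_eq[OF abc], of f] by (simp add: u v w abc closed op)
    qed
  qed
  then show ?thesis
    using cycle_set_axioms bij op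
    by (simp add: cycle_set_iso_def cycle_set_iso_axioms_def cycle_set_hom_def
        cycle_set_hom_axioms_def bij_betw_imp_funcset)
qed

lemma cocycle_identity_of_extension:
  assumes "cycle_set (S \<times> Y) (dynamical_extension_op \<alpha> opY)"
    and "x \<in> Y" "y \<in> Y" "z \<in> Y" "r \<in> S" "s \<in> S" "t \<in> S"
  shows "\<alpha> (opY x y) (opY x z) (\<alpha> x y r s) (\<alpha> x z r t) =
    \<alpha> (opY y x) (opY y z) (\<alpha> y x s r) (\<alpha> y z s t)"
  using cycle_set.cycle_eq[OF assms(1), of "(r, x)" "(s, y)" "(t, z)"] assms(2-)
  by (simp add: dynamical_extension_op_def)

context covering_map
begin

abbreviation fiber :: "'b \<Rightarrow> 'a set" where
  "fiber y \<equiv> {a \<in> X. p a = y}"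

lemma closed_source: "a \<cdot>\<^sub>X b \<in> X" if "a \<in> X" "b \<in> X"
  using source.bij_left[OF that(1)] that(2) by (rule bij_betwE[rule_format])

lemma closed_target: "x \<cdot>\<^sub>Y y \<in> Y" if "x \<in> Y" "y \<in> Y"
  using target.bij_left[OF that(1)] that(2) by (rule bij_betwE[rule_format])

text \<open>The fiber over \<open>y\<close> is mapped into the fiber over \<open>p a \<cdot> y\<close> for every homomorphism; surjectivity
  comes from counting, because the two fibers are finite of equal size.\<close>

lemma bij_betw_left_mult_fiber:
  assumes a: "a \<in> X" and y: "y \<in> Y"
  shows "bij_betw ((\<cdot>\<^sub>X) a) (fiber y) (fiber (p a \<cdot>\<^sub>Y y))"
proof -
  have pa: "p a \<in> Y"
    using a maps_to by auto
  have inj: "inj_on ((\<cdot>\<^sub>X) a) (fiber y)"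
    using source.bij_left[OF a] by (auto simp: bij_betw_def intro: inj_on_subset)
  have "(\<cdot>\<^sub>X) a ` fiber y \<subseteq> fiber (p a \<cdot>\<^sub>Y y)"
    using a by (auto simp: closed_source hom_op)
  moreover have "card ((\<cdot>\<^sub>X) a ` fiber y) = card (fiber (p a \<cdot>\<^sub>Y y))"
    using fibers_same_card[OF y closed_target[OF pa y]] by (simp add: card_image inj)
  ultimately have "(\<cdot>\<^sub>X) a ` fiber y = fiber (p a \<cdot>\<^sub>Y y)"
    using finite_source by (intro card_subset_eq) auto
  with inj show ?thesis
    by (simp add: bij_betw_def)
qed

lemma exists_fiber_labelling:
  "\<exists>(S :: nat set) h. finite S \<and> S \<noteq> {} \<and> (\<forall>y\<in>Y. bij_betw (h y) (fiber y) S)"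
proof (cases "Y = {}")
  \<comment> \<open>There is no fiber to count, but \<open>S\<close> still has to be nonempty.\<close>
  case True
  then show ?thesis
    by (intro exI[of _ "{0}"]) auto
next
  case False
  then obtain y0 where y0: "y0 \<in> Y"
    by blast
  define S where "S = {..<card (fiber y0)}"
  have "fiber y0 \<noteq> {}"
    using surjective y0 by auto
  then have "card (fiber y0) > 0"
    using finite_source by (simp add: card_gt_0_iff)
  then have "S \<noteq> {}"
    by (auto simp: S_def)
  moreover have "\<exists>h. bij_betw h (fiber y) S" if y: "y \<in> Y" for y
    using finite_source fibers_same_card[OF y y0]
    by (intro finite_same_card_bij) (auto simp: S_def)
  then obtain h where "\<forall>y\<in>Y. bij_betw (h y) (fiber y) S"
    by metis
  ultimately show ?thesis
    by (intro exI[of _ S] exI[of _ h]) (auto simp: S_def)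
qed

text \<open>The cocycle read off from a labelling \<open>h\<close> of the fibers by \<open>S\<close>: decode both labels, multiply in
  \<open>X\<close>, and encode the product, which lies over \<open>x \<cdot> y\<close>. Off \<open>S\<close> it is the identity, as required of a
  function that \<open>permutes\<close> \<open>S\<close>.\<close>

definition labelling_cocycle :: "'s set \<Rightarrow> ('b \<Rightarrow> 'a \<Rightarrow> 's) \<Rightarrow> 'b \<Rightarrow> 'b \<Rightarrow> 's \<Rightarrow> 's \<Rightarrow> 's" where
  "labelling_cocycle S h x y s t = (if t \<in> S
     then h (x \<cdot>\<^sub>Y y) (inv_into (fiber x) (h x) s \<cdot>\<^sub>X inv_into (fiber y) (h y) t) else t)"

context
  fixes S :: "'s set" and h :: "'b \<Rightarrow> 'a \<Rightarrow> 's"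
  assumes labelling: "\<And>y. y \<in> Y \<Longrightarrow> bij_betw (h y) (fiber y) S"
begin

lemma labelling_cocycle_permutes:
  assumes x: "x \<in> Y" and y: "y \<in> Y" and s: "s \<in> S"
  shows "labelling_cocycle S h x y s permutes S"
proof (rule bij_imp_permutes)
  define a where "a = inv_into (fiber x) (h x) s"
  have "a \<in> fiber x"
    using bij_betwE[OF bij_betw_inv_into[OF labelling[OF x]]] s by (auto simp: a_def)
  then have a: "a \<in> X" "p a = x"
    by auto
  \<comment> \<open>decoding, then multiplication by \<open>a\<close>, then encoding\<close>
  have "bij_betw (h (x \<cdot>\<^sub>Y y) \<circ> ((\<cdot>\<^sub>X) a \<circ> inv_into (fiber y) (h y))) S S"
    using bij_betw_inv_into[OF labelling[OF y]] bij_betw_left_mult_fiber[OF a(1) y]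
      labelling[OF closed_target[OF x y]]
    unfolding a(2) by (intro bij_betw_trans)
  then show "bij_betw (labelling_cocycle S h x y s) S S"
    by (rule bij_betw_cong[THEN iffD1, rotated]) (simp add: labelling_cocycle_def a_def)
qed (simp add: labelling_cocycle_def)

lemma bij_betw_labelling: "bij_betw (\<lambda>a. (h (p a) a, p a)) X (S \<times> Y)"
  unfolding bij_betw_def
proof
  show "inj_on (\<lambda>a. (h (p a) a, p a)) X"
  proof (rule inj_onI)
    fix a b
    assume ab: "a \<in> X" "b \<in> X" "(h (p a) a, p a) = (h (p b) b, p b)"
    then have "inj_on (h (p a)) (fiber (p a))"
      using labelling[of "p a"] maps_to by (auto simp: bij_betw_def)
    with ab show "a = b"
      by (auto dest: inj_onD)
  qed
  show "(\<lambda>a. (h (p a) a, p a)) ` X = S \<times> Y"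
  proof (intro equalityI subsetI)
    fix u
    assume "u \<in> (\<lambda>a. (h (p a) a, p a)) ` X"
    then obtain a where a: "a \<in> X" and u: "u = (h (p a) a, p a)"
      by blast
    have "p a \<in> Y"
      using a maps_to by auto
    then show "u \<in> S \<times> Y"
      using a bij_betwE[OF labelling[of "p a"]] by (simp add: u)
  next
    fix u
    assume "u \<in> S \<times> Y"
    then obtain s y where u: "u = (s, y)" and s: "s \<in> S" and y: "y \<in> Y"
      by blast
    from s have "s \<in> h y ` fiber y"
      using labelling[OF y] by (simp add: bij_betw_def)
    then show "u \<in> (\<lambda>a. (h (p a) a, p a)) ` X"
      by (auto simp: u)
  qed
qed

lemma labelling_hom:
  assumes a: "a \<in> X" and b: "b \<in> X"
  shows "(h (p (a \<cdot>\<^sub>X b)) (a \<cdot>\<^sub>X b), p (a \<cdot>\<^sub>X b)) =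
    dynamical_extension_op (labelling_cocycle S h) (\<cdot>\<^sub>Y) (h (p a) a, p a) (h (p b) b, p b)"
proof -
  have decode: "inv_into (fiber (p c)) (h (p c)) (h (p c) c) = c"
    and label: "h (p c) c \<in> S" if c: "c \<in> X" for c
  proof -
    have "p c \<in> Y"
      using c maps_to by auto
    from labelling[OF this] c show "inv_into (fiber (p c)) (h (p c)) (h (p c) c) = c"
      and "h (p c) c \<in> S"
      by (auto simp: bij_betw_def)
  qed
  show ?thesis
    using a b
    by (simp add: dynamical_extension_op_def labelling_cocycle_def decode label hom_op)
qed

lemma cycle_set_iso_labelling:
  "cycle_set_iso X (\<cdot>\<^sub>X) (S \<times> Y) (dynamical_extension_op (labelling_cocycle S h) (\<cdot>\<^sub>Y))
    (\<lambda>a. (h (p a) a, p a))"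
  using bij_betw_labelling labelling_hom by (rule source.cycle_set_iso_transport)

lemma labelling_cocycle_in_cocycles: "labelling_cocycle S h \<in> dynamical_cocycles Y (\<cdot>\<^sub>Y) S"
proof -
  have "cycle_set (S \<times> Y) (dynamical_extension_op (labelling_cocycle S h) (\<cdot>\<^sub>Y))"
    using cycle_set_iso_labelling by (simp add: cycle_set_iso_def cycle_set_hom_def)
  from cocycle_identity_of_extension[OF this] labelling_cocycle_permutes show ?thesis
    unfolding dynamical_cocycles_def by blast
qed

end

end

theorem theorem2p12:
  fixes X :: "'a set" and opX :: "'a \<Rightarrow> 'a \<Rightarrow> 'a"
    and Y :: "'b set" and opY :: "'b \<Rightarrow> 'b \<Rightarrow> 'b"
    and p :: "'a \<Rightarrow> 'b"
  assumes "cycle_set X opX" and "finite X"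
    and "cycle_set Y opY" and "finite Y"
    and "covering_map X opX Y opY p"
  shows "\<exists>(S :: nat set) \<alpha>. finite S \<and> S \<noteq> {} \<and> \<alpha> \<in> dynamical_cocycles Y opY S \<and>
    cycle_set_isomorphic X opX (S \<times> Y) (dynamical_extension_op \<alpha> opY)"
proof -
  interpret covering_map X opX Y opY p
    by fact
  obtain S :: "nat set" and h where S: "finite S" "S \<noteq> {}"
    and h: "\<And>y. y \<in> Y \<Longrightarrow> bij_betw (h y) (fiber y) S"
    using exists_fiber_labelling by blast
  show ?thesis
    using S labelling_cocycle_in_cocycles[OF h] cycle_set_iso_labelling[OF h]
    unfolding cycle_set_isomorphic_def by blast
qed

end
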